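(* Let $\Gamma$ be a binary group and $\Omega\subseteq\Gamma$, and suppose the Cayley graph $\mathrm{Cay}(\Gamma,\Omega)$ has odd-girth $2k+1$. Then the projective cube $\mathcal{PC}_{2k}$ is a subgraph of $\mathrm{Cay}(\Gamma,\Omega)$.
   Context: A binary group is a group $\Gamma$ (written additively) in which $x+x=0$ for every $x\in\Gamma$. For $\Omega\subseteq\Gamma$, the Cayley graph $\mathrm{Cay}(\Gamma,\Omega)$ has vertex set $\Gamma$, with $u$ and $v$ adjacent if and only if $u-v\in\Omega$. The odd-girth of a graph is the length of its shortest odd cycle. The projective cube of dimension $d$, $\mathcal{PC}_d$, is the Cayley graph $\mathrm{Cay}(\mathbb{Z}_2^d,\{e_1,\dots,e_d,J\})$, where $e_1,\dots,e_d$ is the canonical basis of $\mathbb{Z}_2^d$ and $J$ is the all-ones vector. *)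

theory Defs
  imports
    "HOL-Algebra.Elementary_Groups"
    "HOL-Algebra.Product_Groups"
    "HOL-Library.Extended_Nat"
    "Graph_Theory.Graph_Theory"
begin

locale binary_group = group +
  assumes mult_self: "x \<in> carrier G \<Longrightarrow> x \<otimes> x = \<one>"

text \<open>
  Undirected graphs are represented as symmetric digraphs, one arc in each direction; over a
  binary group \<^term>\<open>u \<otimes>\<^bsub>G\<^esub> inv\<^bsub>G\<^esub> v\<close> is symmetric in \<^term>\<open>u\<close> and \<^term>\<open>v\<close>. There is a loop at every
  vertex if the connection set contains the neutral element.
\<close>

definition cayley_graph :: "('a, 'm) monoid_scheme \<Rightarrow> 'a set \<Rightarrow> ('a, 'a \<times> 'a) pre_digraph" where
  "cayley_graph G \<Omega> =
     \<lparr>verts = carrier G,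
      arcs = {(u, v). u \<in> carrier G \<and> v \<in> carrier G \<and> u \<otimes>\<^bsub>G\<^esub> inv\<^bsub>G\<^esub> v \<in> \<Omega>},
      tail = fst, head = snd\<rparr>"

text \<open>
  Back-and-forth walks along an edge count as cycles in a symmetric digraph, but they have even
  length, so the odd cycles are exactly those of the undirected graph, a loop being an odd cycle
  of length one. The value is \<^term>\<open>\<infinity>\<close> if there is no odd cycle.
\<close>

definition odd_girth :: "('a, 'b) pre_digraph \<Rightarrow> enat" where
  "odd_girth X = Inf {enat (length p) | p. pre_digraph.cycle X p \<and> odd (length p)}"

definition binary_cube_group :: "nat \<Rightarrow> (nat \<Rightarrow> int) monoid" where
  "binary_cube_group d = product_group {..<d} (\<lambda>_. integer_mod_group 2)"

definition unit_vector :: "nat \<Rightarrow> nat \<Rightarrow> nat \<Rightarrow> int" where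
  "unit_vector d i = (\<lambda>j\<in>{..<d}. if j = i then 1 else 0)"

definition ones_vector :: "nat \<Rightarrow> nat \<Rightarrow> int" where
  "ones_vector d = (\<lambda>j\<in>{..<d}. 1)"

definition projective_cube :: "nat \<Rightarrow> (nat \<Rightarrow> int, (nat \<Rightarrow> int) \<times> (nat \<Rightarrow> int)) pre_digraph" where
  "projective_cube d =
     cayley_graph (binary_cube_group d) (insert (ones_vector d) (unit_vector d ` {..<d}))"

text \<open>Being a subgraph is understood up to isomorphism.\<close>

definition is_subgraph_of ::
    "('a, 'b) pre_digraph \<Rightarrow> ('c, 'd) pre_digraph \<Rightarrow> bool" where
  "is_subgraph_of X Y \<longleftrightarrow> (\<exists>H. subgraph H Y \<and> digraph_iso X H)"

end

theory Submission
  imports Defs "HOL-Algebra.FiniteProduct"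
begin

text \<open>
  Let \<open>\<omega> 0, \<dots>, \<omega> (2 * k)\<close> be the increments along a shortest odd cycle; they lie in \<open>\<Omega>\<close> and their
  product is the neutral element. Send the \<open>i\<close>-th unit vector of the cube to \<open>\<omega> i\<close>; then the all-ones
  vector goes to the product of all \<open>\<omega> i\<close> with \<open>i < 2 * k\<close>, which is \<open>\<omega> (2 * k)\<close>. This homomorphism
  is injective: a nonzero vector in the kernel has as support a nonempty \<open>S \<subseteq> {..<2 * k}\<close> over
  which the product of \<open>\<omega>\<close> is trivial, and the same holds for the complement of \<open>S\<close> in
  \<open>{..2 * k}\<close>. One of the two sets has odd size, which yields an odd closed walk, hence an odd
  cycle, shorter than \<open>2 * k + 1\<close>.
\<close>

text \<open>A repeated vertex splits a closed walk into two shorter closed walks, and one of them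
  has odd length because the lengths add up to an odd number.\<close>

lemma (in wf_digraph) odd_closed_walk_imp_odd_cycle:
  assumes "awalk u p u" "odd (length p)"
  shows "\<exists>c. cycle c \<and> odd (length c) \<and> length c \<le> length p"
  using assms
proof (induction "length p" arbitrary: u p rule: less_induct)
  case less
  show ?case
  proof (cases "distinct (tl (awalk_verts u p))")
    case True
    then show ?thesis
      using less.prems by (auto simp: cycle_def intro!: exI[of _ p] exI[of _ u])
  next
    case False
    from less.prems(2) obtain a p' where p: "p = a # p'"
      by (cases p) auto
    then have a: "awalk u [a] (head G a)" and p': "awalk (head G a) p' u"
      using less.prems(1) by (auto simp: awalk_Cons_iff awalk_Nil_iff)
    \<comment> \<open>Start and end of a closed walk always coincide, so only a repetition after the
      first arc counts. Removing the loop \<open>r\<close> from \<open>p'\<close> leaves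
      \<open>a\<close> in place, so both closed walks are nonempty.\<close>
    have "\<not> distinct (awalk_verts (head G a) p')"
      using False p by simp
    then obtain q r s y where qrs: "p' = q @ r @ s" "r \<noteq> []"
        "awalk (head G a) q y" "awalk y r y" "awalk y s u"
      using awalk_not_distinct_decomp[OF p'] by auto
    have "awalk u ([a] @ q @ s) u"
      using a qrs by (meson awalk_appendI)
    moreover have "odd (length r) \<or> odd (length ([a] @ q @ s))"
      using less.prems(2) p qrs(1) by auto
    moreover have "length r < length p" "length ([a] @ q @ s) < length p"
      using p qrs(1,2) by auto
    ultimately show ?thesis
      using less.hyps[OF _ qrs(4)] less.hyps[of "[a] @ q @ s" u] by (meson le_trans less_imp_le)
  qed
qed

section \<open>Cayley graphs and their images under homomorphisms\<close>

lemma cayley_graph_simps [simp]: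
  "verts (cayley_graph G S) = carrier G"
  "arcs (cayley_graph G S) =
     {(u, v). u \<in> carrier G \<and> v \<in> carrier G \<and> u \<otimes>\<^bsub>G\<^esub> inv\<^bsub>G\<^esub> v \<in> S}"
  "tail (cayley_graph G S) = fst"
  "head (cayley_graph G S) = snd"
  by (simp_all add: cayley_graph_def)

lemma wf_digraph_cayley_graph: "wf_digraph (cayley_graph G S)"
  by unfold_locales auto

text \<open>A homomorphism carries the difference of two vertices to the difference of their images,
  so arcs go to arcs; injectivity makes the map an isomorphism onto its image.\<close>

lemma hom_imp_is_subgraph_of_cayley_graph:
  assumes "group G" "group H" "h \<in> hom G H" "inj_on h (carrier G)" "S \<subseteq> carrier G" "h ` S \<subseteq> T"
  shows "is_subgraph_of (cayley_graph G S) (cayley_graph H T)"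
proof -
  interpret group_hom G H h
    using assms by (auto simp: group_hom_def group_hom_axioms_def)
  let ?X = "cayley_graph G S" and ?Y = "cayley_graph H T"
  \<comment> \<open>The image graph keeps \<open>fst\<close> and \<open>snd\<close> as tail and
    head, so that it is compatible with \<open>?Y\<close>.\<close>
  let ?f = "\<lparr>iso_verts = h, iso_arcs = map_prod h h, iso_head = snd, iso_tail = fst\<rparr>"
  have inj: "inj_on (map_prod h h) (arcs ?X)"
    by (rule inj_on_subset[OF map_prod_inj_on[OF assms(4) assms(4)]]) auto
  have iso: "pre_digraph.digraph_isomorphism ?X ?f"
    unfolding pre_digraph.digraph_isomorphism_def
    using inj assms(4) wf_digraph_cayley_graph[of G S] by auto
  have "h u \<otimes>\<^bsub>H\<^esub> inv\<^bsub>H\<^esub> h v \<in> T" if "u \<in> carrier G" "v \<in> carrier G" "u \<otimes>\<^bsub>G\<^esub> inv\<^bsub>G\<^esub> v \<in> S" for u v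
  proof -
    have "h (u \<otimes>\<^bsub>G\<^esub> inv\<^bsub>G\<^esub> v) \<in> T"
      using that(3) assms(6) by blast
    then show ?thesis
      using that by simp
  qed
  then have "subgraph (app_iso ?f ?X) ?Y"
    using wf_digraph_cayley_graph[of H T]
      wf_digraph.wf_digraphI_app_iso[OF wf_digraph_cayley_graph iso]
    unfolding subgraph_def compatible_def by auto
  then show ?thesis
    using iso unfolding is_subgraph_of_def digraph_iso_def by blast
qed

section \<open>Walks in Cayley graphs of binary groups as products\<close>

lemma (in binary_group) inv_self: "x \<in> carrier G \<Longrightarrow> inv x = x"
  by (simp add: inv_equality mult_self)

text \<open>Every element is its own inverse, so inverting a product, which reverses its factors,
  does not change it. Commutativity makes \<open>finprod\<close> usable.\<close>

sublocale binary_group \<subseteq> comm_group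
proof (rule group.group_comm_groupI)
  show "x \<otimes> y = y \<otimes> x" if "x \<in> carrier G" "y \<in> carrier G" for x y
    using inv_mult_group[OF that] inv_self that by simp
qed (rule is_group)

context binary_group
begin

text \<open>Multiplying by the factors one after another traces a walk. The start \<open>u\<close>
  varies in the induction because each step moves it.\<close>

lemma awalk_finprod:
  assumes "finite S" "w \<in> S \<rightarrow> \<Omega>" "\<Omega> \<subseteq> carrier G" "u \<in> carrier G"
  shows "\<exists>p. pre_digraph.awalk (cayley_graph G \<Omega>) u p (u \<otimes> finprod G w S) \<and> length p = card S"
  using assms
proof (induction S arbitrary: u rule: finite_induct)
  case empty
  then show ?case
    by (simp add: pre_digraph.awalk_def pre_digraph.cas.simps)
next
  case (insert i S)
  interpret X: wf_digraph "cayley_graph G \<Omega>"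
    by (rule wf_digraph_cayley_graph)
  have w: "w i \<in> \<Omega>" "w i \<in> carrier G" "w \<in> S \<rightarrow> \<Omega>" "w \<in> S \<rightarrow> carrier G"
    using insert.prems by auto
  then obtain p where p: "X.awalk (u \<otimes> w i) p (u \<otimes> w i \<otimes> finprod G w S)" "length p = card S"
    using insert.IH insert.prems by blast
  have "u \<otimes> inv (u \<otimes> w i) = w i"
    using w insert.prems by (metis inv_self m_assoc m_closed mult_self l_one)
  then have "X.awalk u ((u, u \<otimes> w i) # p) (u \<otimes> w i \<otimes> finprod G w S)"
    using p w insert.prems by (simp add: X.awalk_Cons_iff)
  moreover have "u \<otimes> w i \<otimes> finprod G w S = u \<otimes> finprod G w (insert i S)"
    using w insert by (simp add: m_assoc)
  ultimately show ?case
    using p(2) insert.hyps by (metis card_insert_disjoint length_Cons)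
qed

text \<open>A trivial product closes the walk from the neutral element, and an odd closed walk
  contains an odd cycle that is no longer.\<close>

lemma odd_girth_le_card:
  assumes "finite S" "w \<in> S \<rightarrow> \<Omega>" "\<Omega> \<subseteq> carrier G" "finprod G w S = \<one>" "odd (card S)"
  shows "odd_girth (cayley_graph G \<Omega>) \<le> enat (card S)"
proof -
  interpret X: wf_digraph "cayley_graph G \<Omega>"
    by (rule wf_digraph_cayley_graph)
  obtain p where "X.awalk \<one> p \<one>" "length p = card S"
    using awalk_finprod[OF assms(1-3), of \<one>] assms(4) by auto
  then obtain c where "X.cycle c" "odd (length c)" "length c \<le> card S"
    using X.odd_closed_walk_imp_odd_cycle assms(5) by metis
  then show ?thesis
    unfolding odd_girth_def by (intro Inf_lower2[of "enat (length c)"]) auto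
qed

text \<open>The product telescopes along the walk. Induction from the right keeps the indices of the
  earlier arcs unchanged.\<close>

lemma finprod_awalk:
  assumes "pre_digraph.awalk (cayley_graph G \<Omega>) u p v"
  shows "(\<Otimes>i\<in>{..<length p}. fst (p ! i) \<otimes> inv snd (p ! i)) = u \<otimes> inv v"
  using assms
proof (induction p arbitrary: v rule: rev_induct)
  case Nil
  then show ?case
    by (auto simp: pre_digraph.awalk_def pre_digraph.cas.simps)
next
  case (snoc a p)
  interpret X: wf_digraph "cayley_graph G \<Omega>"
    by (rule wf_digraph_cayley_graph)
  obtain b where b: "X.awalk u p b" "X.awalk b [a] v"
    using snoc.prems by auto
  then have a: "a = (b, v)" "b \<in> carrier G" "v \<in> carrier G" and u: "u \<in> carrier G"
    by (auto simp: X.awalk_Cons_iff X.awalk_Nil_iff X.awalk_def)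
  have p: "fst (p ! i) \<in> carrier G" "snd (p ! i) \<in> carrier G" if "i < length p" for i
    using that b(1) nth_mem[OF that] unfolding X.awalk_def by (fastforce simp: subset_iff)+
  have "(\<Otimes>i\<in>{..<length (p @ [a])}. fst ((p @ [a]) ! i) \<otimes> inv snd ((p @ [a]) ! i))
      = (b \<otimes> inv v) \<otimes> (\<Otimes>i\<in>{..<length p}. fst ((p @ [a]) ! i) \<otimes> inv snd ((p @ [a]) ! i))"
    using p a by (simp add: lessThan_Suc nth_append Pi_def del: finprod_multf)
  also have "(\<Otimes>i\<in>{..<length p}. fst ((p @ [a]) ! i) \<otimes> inv snd ((p @ [a]) ! i)) = u \<otimes> inv b"
    using p by (subst snoc.IH[OF b(1), symmetric], intro finprod_cong') (auto simp: nth_append)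
  also have "(b \<otimes> inv v) \<otimes> (u \<otimes> inv b) = u \<otimes> inv v"
    using a u by (metis inv_self m_assoc m_closed m_comm mult_self r_one)
  finally show ?case .
qed

lemma odd_girth_obtain_word:
  assumes "odd_girth (cayley_graph G \<Omega>) = enat n"
  obtains w where "w \<in> {..<n} \<rightarrow> \<Omega>" "finprod G w {..<n} = \<one>"
proof -
  interpret X: wf_digraph "cayley_graph G \<Omega>"
    by (rule wf_digraph_cayley_graph)
  \<comment> \<open>A finite infimum in \<open>enat\<close> comes from a nonempty set and is
    attained as its least element.\<close>
  have "odd_girth (cayley_graph G \<Omega>) \<in> {enat (length p) | p. X.cycle p \<and> odd (length p)}"
    using assms unfolding odd_girth_def Inf_enat_def
    by (metis (lifting) LeastI_ex enat.distinct(1) ex_in_conv)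
  then obtain p u where p: "length p = n" "X.awalk u p u"
    using assms by (auto simp: X.cycle_def)
  define w where "w = (\<lambda>i. fst (p ! i) \<otimes> inv snd (p ! i))"
  have "w i \<in> \<Omega>" if "i < n" for i
    using that p nth_mem[of i p] unfolding X.awalk_def w_def by (fastforce simp: subset_iff)
  moreover have "finprod G w {..<n} = \<one>"
    using finprod_awalk[OF p(2)] p by (auto simp: w_def X.awalk_def)
  ultimately show ?thesis
    using that by auto
qed

end

section \<open>The homomorphism from the cube group\<close>

lemma group_binary_cube_group: "group (binary_cube_group d)"
  unfolding binary_cube_group_def by (rule product_group) simp

lemma carrier_binary_cube_group: "carrier (binary_cube_group d) = {..<d} \<rightarrow>\<^sub>E {0, 1}"
proof -
  have "{0..<2} = {0, 1 :: int}"
    by auto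
  then show ?thesis
    by (simp add: binary_cube_group_def carrier_integer_mod_group)
qed

text \<open>Over a binary group this is the linear extension of \<open>w\<close> from the canonical
  basis of the cube, with coordinates represented by the integers 0 and 1.\<close>

definition (in group) cube_hom :: "nat \<Rightarrow> (nat \<Rightarrow> 'a) \<Rightarrow> (nat \<Rightarrow> int) \<Rightarrow> 'a" where
  "cube_hom d w x = (\<Otimes>i\<in>{..<d}. if x i = 1 then w i else \<one>)"

context binary_group
begin

lemma cube_hom_hom:
  assumes w: "w \<in> {..<d} \<rightarrow> carrier G"
  shows "cube_hom d w \<in> hom (binary_cube_group d) G"
proof (rule homI)
  show "cube_hom d w x \<in> carrier G" for x
    using w unfolding cube_hom_def by (intro finprod_closed) auto
  fix x y
  assume xy: "x \<in> carrier (binary_cube_group d)" "y \<in> carrier (binary_cube_group d)"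
  have "x i = 0 \<or> x i = 1" "y i = 0 \<or> y i = 1" "w i \<in> carrier G" if "i < d" for i
    using that xy w unfolding carrier_binary_cube_group by (auto dest!: PiE_mem)
  then have "cube_hom d w (x \<otimes>\<^bsub>binary_cube_group d\<^esub> y)
      = (\<Otimes>i\<in>{..<d}. (if x i = 1 then w i else \<one>) \<otimes> (if y i = 1 then w i else \<one>))"
    unfolding cube_hom_def
    \<comment> \<open>Factors are compared by coordinate values; where both are 1 the sum is 0
      modulo 2, matched by \<open>w i\<close> cancelling itself.\<close>
    by (intro finprod_cong') (fastforce simp: binary_cube_group_def mult_self)+
  also have "\<dots> = cube_hom d w x \<otimes> cube_hom d w y"
    using w unfolding cube_hom_def by (intro finprod_multf) auto
  finally show "cube_hom d w (x \<otimes>\<^bsub>binary_cube_group d\<^esub> y) = cube_hom d w x \<otimes> cube_hom d w y" .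
qed

lemma cube_hom_support:
  assumes "w \<in> {..<d} \<rightarrow> carrier G"
  shows "cube_hom d w x = finprod G w {i \<in> {..<d}. x i = 1}"
  unfolding cube_hom_def using assms by (intro finprod_mono_neutral_cong_right) auto

lemma cube_hom_unit_vector:
  assumes "w \<in> {..<d} \<rightarrow> carrier G" "i < d"
  shows "cube_hom d w (unit_vector d i) = w i"
proof -
  have "{j \<in> {..<d}. unit_vector d i j = 1} = {i}"
    using assms by (auto simp: unit_vector_def split: if_splits)
  moreover have "finprod G w {i} = w i"
    using assms by (subst finprod_insert[of "{}"]) (auto simp: Pi_iff)
  ultimately show ?thesis
    using assms by (simp add: cube_hom_support)
qed

lemma cube_hom_ones_vector:
  assumes "w \<in> {..<d} \<rightarrow> carrier G"
  shows "cube_hom d w (ones_vector d) = finprod G w {..<d}"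
proof -
  have "{j \<in> {..<d}. ones_vector d j = 1} = {..<d}"
    by (auto simp: ones_vector_def)
  then show ?thesis
    using assms by (simp add: cube_hom_support)
qed

lemma cube_hom_inj:
  assumes w: "w \<in> {..<2 * k + 1} \<rightarrow> \<Omega>" and \<Omega>: "\<Omega> \<subseteq> carrier G"
    and prod: "finprod G w {..<2 * k + 1} = \<one>"
    and girth: "odd_girth (cayley_graph G \<Omega>) = enat (2 * k + 1)"
  shows "inj_on (cube_hom (2 * k) w) (carrier (binary_cube_group (2 * k)))"
proof -
  let ?d = "2 * k"
  have wc: "w \<in> A \<rightarrow> carrier G" "w \<in> A \<rightarrow> \<Omega>" if "A \<subseteq> {..<?d + 1}" for A
    using w \<Omega> that by auto
  interpret h: group_hom "binary_cube_group ?d" G "cube_hom ?d w"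
    using cube_hom_hom[OF wc(1)] group_binary_cube_group
    by (auto simp: group_hom_def group_hom_axioms_def)
  have "x i = 0" if x: "x \<in> carrier (binary_cube_group ?d)" "cube_hom ?d w x = \<one>" and i: "i < ?d" for x i
  proof (rule ccontr)
    assume "x i \<noteq> 0"
    define S where "S = {i \<in> {..<?d}. x i = 1}"
    \<comment> \<open>The complement includes the last index \<open>?d\<close>, since only the
      product over all \<open>?d + 1\<close> factors is known to be trivial.\<close>
    define T where "T = {..<?d + 1} - S"
    have "x i = 1"
      using x(1) i \<open>x i \<noteq> 0\<close> by (auto simp: carrier_binary_cube_group dest: PiE_mem)
    then have S: "S \<subseteq> {..<?d + 1}" "i \<in> S" "finite S" "finprod G w S = \<one>"
      using x i cube_hom_support[OF wc(1), of ?d x] by (auto simp: S_def)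
    have T: "T \<subseteq> {..<?d + 1}" "finite T" "S \<union> T = {..<?d + 1}" "S \<inter> T = {}"
      using S by (auto simp: T_def)
    have "finprod G w (S \<union> T) = finprod G w S \<otimes> finprod G w T"
      using S T wc(1)[of S] wc(1)[of T] by (intro finprod_Un_disjoint) auto
    then have prodT: "finprod G w T = \<one>"
      using S(4) T(1,3) prod wc(1)[of T] by simp
    have card: "card S + card T = ?d + 1"
      using card_Un_disjoint[OF S(3) T(2,4)] T(3) by simp
    \<comment> \<open>Membership of \<open>?d\<close> in \<open>T\<close> and of \<open>i\<close> in
      \<open>S\<close> makes both sets proper, so whichever has odd size undercuts the
      odd-girth.\<close>
    have "?d \<in> T"
      by (simp add: T_def S_def)
    then have lt: "card S < ?d + 1" "card T < ?d + 1"
      using card S(2,3) T(2) card_gt_0_iff[of S] card_gt_0_iff[of T] by auto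
    from card have "odd (card S) \<or> odd (card T)"
      by presburger
    then show False
      using odd_girth_le_card[OF S(3) wc(2) \<Omega> S(4)] odd_girth_le_card[OF T(2) wc(2) \<Omega> prodT]
        S(1) T(1) lt girth by auto
  qed
  then have "x = \<one>\<^bsub>binary_cube_group ?d\<^esub>"
    if "x \<in> carrier (binary_cube_group ?d)" "cube_hom ?d w x = \<one>" for x
    using that by (intro PiE_ext[of x "{..<?d}" "\<lambda>_. {0, 1}"])
      (auto simp: carrier_binary_cube_group binary_cube_group_def)
  then show ?thesis
    by (auto simp: h.inj_on_one_iff)
qed

end

theorem theorem5:
  fixes \<Gamma> :: "('a, 'm) monoid_scheme" and \<Omega> :: "'a set" and k :: nat
  assumes "binary_group \<Gamma>"
    and "\<Omega> \<subseteq> carrier \<Gamma>"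
    and "odd_girth (cayley_graph \<Gamma> \<Omega>) = enat (2 * k + 1)"
  shows "is_subgraph_of (projective_cube (2 * k)) (cayley_graph \<Gamma> \<Omega>)"
proof -
  interpret binary_group \<Gamma>
    by (rule assms(1))
  let ?d = "2 * k"
  obtain w where w: "w \<in> {..<?d + 1} \<rightarrow> \<Omega>" "finprod \<Gamma> w {..<?d + 1} = \<one>\<^bsub>\<Gamma>\<^esub>"
    using odd_girth_obtain_word[OF assms(3)] .
  have wc: "w \<in> {..<?d} \<rightarrow> carrier \<Gamma>" and wd: "w ?d \<in> carrier \<Gamma>"
    using w(1) assms(2) by (auto simp: Pi_iff)
  \<comment> \<open>Splitting off the last factor shows that the remaining product is the inverse of
    \<open>w ?d\<close>, hence \<open>w ?d\<close> itself; this puts the image of the all-ones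
    vector in \<open>\<Omega>\<close>.\<close>
  have "w ?d \<otimes>\<^bsub>\<Gamma>\<^esub> finprod \<Gamma> w {..<?d} = \<one>\<^bsub>\<Gamma>\<^esub>"
    using w(2) wc wd by (simp add: lessThan_Suc)
  then have "finprod \<Gamma> w {..<?d} = w ?d"
    using inv_self[OF wd] wc wd by (metis finprod_closed inv_equality inv_inv)
  then have "cube_hom ?d w ` insert (ones_vector ?d) (unit_vector ?d ` {..<?d}) \<subseteq> \<Omega>"
    using w(1) wc by (auto simp: cube_hom_ones_vector cube_hom_unit_vector)
  moreover have "insert (ones_vector ?d) (unit_vector ?d ` {..<?d}) \<subseteq> carrier (binary_cube_group ?d)"
    by (auto simp: carrier_binary_cube_group ones_vector_def unit_vector_def PiE_iff
        split: if_splits)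
  ultimately show ?thesis
    unfolding projective_cube_def
    using cube_hom_hom[OF wc] cube_hom_inj[OF w(1) assms(2) w(2) assms(3)] group_binary_cube_group is_group
    by (intro hom_imp_is_subgraph_of_cayley_graph)
qed

end
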